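(* Let $X,Y$ be finite sets, let $f:X\times Y\to\{0,1\}$ be a function, and let $N\geq 1$ be an integer. If $f$ has an upper-triangular 1-fooling set of size $N$, then $$Q_1^*(f)\;\geq\;\tfrac12\log_2 N-\tfrac12 .$$
   Context: Upper-triangular 1-fooling set. A 1-fooling set for $f$ is a set $F\subseteq X\times Y$ such that (1) $f(x,y)=1$ for all $(x,y)\in F$, and (2) for any two distinct $(x,y),(x',y')\in F$, $f(x,y')=0$ or $f(x',y)=0$. It is upper-triangular of size $N$ if its elements can be listed as $(x_1,y_1),\dots,(x_N,y_N)$ so that $f(x_i,y_j)=0$ whenever $i>j$. (After renaming Bob's inputs the set has the form $\{(x,x)\}$, and the condition says that for some total order, $x>y$ implies $f(x,y)=0$.) Quantum protocols with prior entanglement. Alice receives $x\in X$, Bob receives $y\in Y$. A $q$-qubit protocol ($q\ge 1$) starts in a fixed state (independent of the inputs) on finite-dimensional registers, some held by Alice and the others by Bob; this state may be arbitrarily entangled between them and may include local ancillas of any finite dimension. There are $q$ rounds. In round $t$, a designated sender (depending only on $t$) applies a unitary, depending on $t$ and on the sender's own input, to all registers the sender currently holds, and then transfers one designated qubit to the other party. The output is the result of measuring the last transferred qubit in the computational basis. One-sided-error complexity. $Q_1^*(f)$ is the minimal $q$ for which some $q$-qubit protocol with prior entanglement outputs 1 with probability $0$ on every $(x,y)$ with $f(x,y)=0$, and outputs 1 with probability at least $1/2$ on every $(x,y)$ with $f(x,y)=1$. *)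

theory Defs
  imports Complex_Main "HOL-Library.FuncSet" "HOL-Library.Extended_Real"
begin

text \<open>A function \<open>f : X \<times> Y \<rightarrow> {0,1}\<close> is represented by \<open>f :: 'a \<Rightarrow> 'b \<Rightarrow> bool\<close>, with
  \<open>True\<close> for 1; its values outside \<open>X \<times> Y\<close> are never used.\<close>

definition one_fooling_set ::
    "'a set \<Rightarrow> 'b set \<Rightarrow> ('a \<Rightarrow> 'b \<Rightarrow> bool) \<Rightarrow> ('a \<times> 'b) set \<Rightarrow> bool" where
  "one_fooling_set X Y f F \<longleftrightarrow>
     F \<subseteq> X \<times> Y \<and>
     (\<forall>(x, y) \<in> F. f x y) \<and>
     (\<forall>(x, y) \<in> F. \<forall>(x', y') \<in> F. (x, y) \<noteq> (x', y') \<longrightarrow> \<not> f x y' \<or> \<not> f x' y)"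

definition upper_triangular ::
    "('a \<Rightarrow> 'b \<Rightarrow> bool) \<Rightarrow> ('a \<times> 'b) set \<Rightarrow> nat \<Rightarrow> bool" where
  "upper_triangular f F N \<longleftrightarrow>
     (\<exists>e. bij_betw e {1..N} F \<and>
        (\<forall>i \<in> {1..N}. \<forall>j \<in> {1..N}. i > j \<longrightarrow> \<not> f (fst (e i)) (snd (e j))))"

datatype party = Alice | Bob

primrec other :: "party \<Rightarrow> party" where
  "other Alice = Bob"
| "other Bob = Alice"

text \<open>The registers are \<open>0, \<dots>, nregs - 1\<close>, register \<open>r\<close> having dimension \<open>dim r\<close>. A
  computational basis state of a set \<open>S\<close> of registers is an assignment
  \<open>\<sigma> \<in> (\<Pi>\<^sub>E r\<in>S. {..<dim r})\<close>. State vectors are given by their amplitudes and operators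
  by their matrix entries in these bases; values at other arguments are irrelevant.
  Rounds are numbered from 0. Only the unitaries of the sender of a round are used in that
  round.\<close>

type_synonym basis_state = "nat \<Rightarrow> nat"
type_synonym state_vec = "basis_state \<Rightarrow> complex"
type_synonym op_matrix = "basis_state \<Rightarrow> basis_state \<Rightarrow> complex"

record ('a, 'b) protocol =
  nregs :: nat
  dim :: "nat \<Rightarrow> nat"
  init_owner :: "nat \<Rightarrow> party"
  init_state :: state_vec
  sender :: "nat \<Rightarrow> party"
  sent_qubit :: "nat \<Rightarrow> nat"
  alice_op :: "nat \<Rightarrow> 'a \<Rightarrow> op_matrix"
  bob_op :: "nat \<Rightarrow> 'b \<Rightarrow> op_matrix"

definition basis :: "('a, 'b) protocol \<Rightarrow> nat set \<Rightarrow> basis_state set" where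
  "basis P S = (\<Pi>\<^sub>E r\<in>S. {..<dim P r})"

abbreviation all_regs :: "('a, 'b) protocol \<Rightarrow> nat set" where
  "all_regs P \<equiv> {..<nregs P}"

text \<open>The owner of each register at the beginning of round \<open>t\<close>.\<close>

primrec owner :: "('a, 'b) protocol \<Rightarrow> nat \<Rightarrow> nat \<Rightarrow> party" where
  "owner P 0 = init_owner P"
| "owner P (Suc t) = (owner P t)(sent_qubit P t := other (sender P t))"

definition held :: "('a, 'b) protocol \<Rightarrow> nat \<Rightarrow> party \<Rightarrow> nat set" where
  "held P t p = {r \<in> all_regs P. owner P t r = p}"

definition unitary_on :: "basis_state set \<Rightarrow> op_matrix \<Rightarrow> bool" where
  "unitary_on B U \<longleftrightarrow>
     (\<forall>\<sigma>\<in>B. \<forall>\<tau>\<in>B. (\<Sum>\<rho>\<in>B. cnj (U \<rho> \<sigma>) * U \<rho> \<tau>) = (if \<sigma> = \<tau> then 1 else 0)) \<and>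
     (\<forall>\<sigma>\<in>B. \<forall>\<tau>\<in>B. (\<Sum>\<rho>\<in>B. U \<sigma> \<rho> * cnj (U \<tau> \<rho>)) = (if \<sigma> = \<tau> then 1 else 0))"

text \<open>\<open>(U \<otimes> I) \<psi>\<close>, where \<open>U\<close> acts on the registers in \<open>S\<close>, and the identity on all others.\<close>

definition apply_op :: "('a, 'b) protocol \<Rightarrow> nat set \<Rightarrow> op_matrix \<Rightarrow> state_vec \<Rightarrow> state_vec" where
  "apply_op P S U \<psi> =
     (\<lambda>\<sigma>. \<Sum>\<tau>\<in>basis P S. U (restrict \<sigma> S) \<tau> * \<psi> (override_on \<sigma> \<tau> S))"

definition round_op :: "('a, 'b) protocol \<Rightarrow> 'a \<Rightarrow> 'b \<Rightarrow> nat \<Rightarrow> op_matrix" where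
  "round_op P x y t = (case sender P t of Alice \<Rightarrow> alice_op P t x | Bob \<Rightarrow> bob_op P t y)"

text \<open>The global state after \<open>t\<close> rounds. Transferring a qubit changes its owner only, not
  the state.\<close>

primrec state_after :: "('a, 'b) protocol \<Rightarrow> 'a \<Rightarrow> 'b \<Rightarrow> nat \<Rightarrow> state_vec" where
  "state_after P x y 0 = init_state P"
| "state_after P x y (Suc t) =
     apply_op P (held P t (sender P t)) (round_op P x y t) (state_after P x y t)"

definition qubit_protocol :: "nat \<Rightarrow> 'a set \<Rightarrow> 'b set \<Rightarrow> ('a, 'b) protocol \<Rightarrow> bool" where
  "qubit_protocol q X Y P \<longleftrightarrow>
     q \<ge> 1 \<and>
     (\<forall>r \<in> all_regs P. dim P r \<ge> 1) \<and>
     (\<Sum>\<sigma>\<in>basis P (all_regs P). (cmod (init_state P \<sigma>))\<^sup>2) = 1 \<and>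
     (\<forall>t<q. sent_qubit P t \<in> held P t (sender P t) \<and> dim P (sent_qubit P t) = 2) \<and>
     (\<forall>t<q. sender P t = Alice \<longrightarrow>
        (\<forall>x\<in>X. unitary_on (basis P (held P t Alice)) (alice_op P t x))) \<and>
     (\<forall>t<q. sender P t = Bob \<longrightarrow>
        (\<forall>y\<in>Y. unitary_on (basis P (held P t Bob)) (bob_op P t y)))"

definition prob_one :: "nat \<Rightarrow> ('a, 'b) protocol \<Rightarrow> 'a \<Rightarrow> 'b \<Rightarrow> real" where
  "prob_one q P x y =
     (\<Sum>\<sigma> | \<sigma> \<in> basis P (all_regs P) \<and> \<sigma> (sent_qubit P (q - 1)) = 1.
        (cmod (state_after P x y q \<sigma>))\<^sup>2)"

definition computes_one_sided ::
    "nat \<Rightarrow> 'a set \<Rightarrow> 'b set \<Rightarrow> ('a \<Rightarrow> 'b \<Rightarrow> bool) \<Rightarrow> ('a, 'b) protocol \<Rightarrow> bool" where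
  "computes_one_sided q X Y f P \<longleftrightarrow>
     (\<forall>x\<in>X. \<forall>y\<in>Y. (\<not> f x y \<longrightarrow> prob_one q P x y = 0) \<and>
                   (f x y \<longrightarrow> prob_one q P x y \<ge> 1 / 2))"

text \<open>The minimum is taken in \<open>enat\<close>, where \<open>Inf {} = \<infinity>\<close>.\<close>

definition Q1_star :: "'a set \<Rightarrow> 'b set \<Rightarrow> ('a \<Rightarrow> 'b \<Rightarrow> bool) \<Rightarrow> enat" where
  "Q1_star X Y f =
     Inf {enat q | q. \<exists>P. qubit_protocol q X Y P \<and> computes_one_sided q X Y f P}"

end

theory Submission imports Defs begin

text \<open>Each transferred qubit is split as \<open>\<Sum>\<^sub>i |i\<rangle>\<langle>i|\<close>, so the final state is a sum over
  \<open>m \<in> {0,1}\<^sup>q\<close> of \<open>(A\<^sub>m(x) \<otimes> B\<^sub>m(y)) \<psi>\<close>. Equivalently it is \<open>(K\<^sub>x \<otimes> L\<^sub>y) \<Omega>\<close>, where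
  \<open>\<Omega> = \<Sum>\<^sub>m \<psi> \<otimes> |m\<rangle>|m\<rangle>\<close> has squared norm \<open>2\<^sup>q\<close>, and \<open>\<parallel>K\<^sub>x\<parallel>\<^sup>2 \<parallel>L\<^sub>y\<parallel>\<^sup>2 \<le> 2\<^sup>q\<close> because each
  sending step costs a factor 2 (this is postselected teleportation). Projecting onto output 1
  gives \<open>(K\<^sub>x\<^sub>i \<otimes> L\<^sub>y\<^sub>j) \<Omega> = 0\<close> for \<open>i > j\<close>. For contractions with this triangular property,
  the probabilities \<open>\<parallel>(K\<^sub>i \<otimes> L\<^sub>i) \<Omega>\<parallel>\<^sup>2\<close> sum to at most \<open>\<parallel>\<Omega>\<parallel>\<^sup>2\<close>: replacing \<open>\<Omega>\<close> by
  \<open>(1 - L\<^sub>1\<^sup>* L\<^sub>1) \<Omega>\<close> does not affect the terms with \<open>i > 1\<close> and decreases \<open>\<parallel>\<Omega>\<parallel>\<^sup>2\<close> by at least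
  \<open>\<parallel>L\<^sub>1 \<Omega>\<parallel>\<^sup>2\<close>. After rescaling, \<open>N / 2 \<le> 2\<^sup>q \<cdot> 2\<^sup>q\<close>.\<close>

section \<open>Triangular families of contractions\<close>

text \<open>This expansion completes the square twice below: once to bound the adjoint, once to
  bound a residual.\<close>

lemma norm2_diff_scaled:
  fixes a b :: "'i \<Rightarrow> complex" and c :: real
  shows "(\<Sum>i\<in>I. (cmod (a i - b i / of_real c))\<^sup>2) =
    (\<Sum>i\<in>I. (cmod (a i))\<^sup>2) - 2 / c * Re (\<Sum>i\<in>I. a i * cnj (b i)) + (\<Sum>i\<in>I. (cmod (b i))\<^sup>2) / c\<^sup>2"
proof -
  have "(cmod (a i - b i / of_real c))\<^sup>2 =
      (cmod (a i))\<^sup>2 - 2 / c * Re (a i * cnj (b i)) + (cmod (b i))\<^sup>2 / c\<^sup>2" for i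
    unfolding cmod_power2
    by (cases "c = 0") (simp_all add: Re_divide_of_real Im_divide_of_real power2_eq_square field_simps)
  then show ?thesis
    by (simp only: sum.distrib sum_subtractf sum_distrib_left sum_divide_distrib Re_sum)
qed

text \<open>For finite index sets, \<open>c\<close> bounds the square of the Euclidean operator norm
  of the matrix \<open>L\<close> with rows \<open>R\<close> and columns \<open>J\<close>.\<close>

definition op_bound :: "'r set \<Rightarrow> 'j set \<Rightarrow> real \<Rightarrow> ('r \<Rightarrow> 'j \<Rightarrow> complex) \<Rightarrow> bool" where
  "op_bound R J c L \<longleftrightarrow>
     (\<forall>v. (\<Sum>r\<in>R. (cmod (\<Sum>j\<in>J. L r j * v j))\<^sup>2) \<le> c * (\<Sum>j\<in>J. (cmod (v j))\<^sup>2))"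

lemma op_boundD:
  "op_bound R J c L \<Longrightarrow> (\<Sum>r\<in>R. (cmod (\<Sum>j\<in>J. L r j * v j))\<^sup>2) \<le> c * (\<Sum>j\<in>J. (cmod (v j))\<^sup>2)"
  unfolding op_bound_def by blast

text \<open>The characteristic relation of the adjoint, whose matrix entries are
  \<open>cnj (L r j)\<close>.\<close>

lemma adjoint_swap:
  fixes L :: "'r \<Rightarrow> 'j \<Rightarrow> complex"
  shows "(\<Sum>j\<in>J. v j * cnj (\<Sum>r\<in>R. cnj (L r j) * w r)) = (\<Sum>r\<in>R. (\<Sum>j\<in>J. L r j * v j) * cnj (w r))"
proof -
  have "(\<Sum>j\<in>J. v j * cnj (\<Sum>r\<in>R. cnj (L r j) * w r)) = (\<Sum>j\<in>J. \<Sum>r\<in>R. L r j * v j * cnj (w r))"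
    by (simp add: cnj_sum sum_distrib_left mult_ac)
  also have "\<dots> = (\<Sum>r\<in>R. \<Sum>j\<in>J. L r j * v j * cnj (w r))" by (rule sum.swap)
  finally show ?thesis by (simp add: sum_distrib_right)
qed

lemma sum_mult_cnj: "Re (\<Sum>j\<in>J. v j * cnj (v j)) = (\<Sum>j\<in>J. (cmod (v j))\<^sup>2)"
  by (simp add: cmod_power2 power2_eq_square[symmetric])

text \<open>With \<open>u\<close> the adjoint applied to \<open>w\<close> and
  \<open>z = L u\<close>, expanding |w - z/c|^2 >= 0 gives |w|^2 - 2|u|^2/c + |z|^2/c^2 >= 0. The
  hypothesis yields |z|^2 <= c|u|^2, hence |u|^2/c <= |w|^2.\<close>

lemma op_bound_adjoint:
  assumes L: "op_bound R J c L" and c: "c > 0"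
  shows "(\<Sum>j\<in>J. (cmod (\<Sum>r\<in>R. cnj (L r j) * w r))\<^sup>2) \<le> c * (\<Sum>r\<in>R. (cmod (w r))\<^sup>2)"
proof -
  define u where "u j = (\<Sum>r\<in>R. cnj (L r j) * w r)" for j
  define z where "z r = (\<Sum>j\<in>J. L r j * u j)" for r
  let ?u = "\<Sum>j\<in>J. (cmod (u j))\<^sup>2" and ?z = "\<Sum>r\<in>R. (cmod (z r))\<^sup>2"
  have *: "Re (\<Sum>r\<in>R. w r * cnj (z r)) = ?u"
  proof -
    have "(\<Sum>r\<in>R. w r * cnj (z r)) = cnj (\<Sum>r\<in>R. z r * cnj (w r))"
      by (simp add: cnj_sum mult.commute)
    also have "\<dots> = cnj (\<Sum>j\<in>J. u j * cnj (u j))"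
      unfolding z_def adjoint_swap[symmetric] u_def ..
    finally show ?thesis by (simp add: sum_mult_cnj del: Re_sum cnj_sum)
  qed
  have "0 \<le> (\<Sum>r\<in>R. (cmod (w r - z r / of_real c))\<^sup>2)" by (simp add: sum_nonneg)
  also have "\<dots> = (\<Sum>r\<in>R. (cmod (w r))\<^sup>2) - 2 / c * ?u + ?z / c\<^sup>2"
    unfolding norm2_diff_scaled * ..
  also have "?z / c\<^sup>2 \<le> c * ?u / c\<^sup>2"
    using op_boundD[OF L, of u] c by (intro divide_right_mono) (simp_all add: z_def)
  also have "c * ?u / c\<^sup>2 = ?u / c" using c by (simp add: power2_eq_square)
  finally have "?u / c \<le> (\<Sum>r\<in>R. (cmod (w r))\<^sup>2)" by simp
  then show ?thesis using c unfolding u_def by (simp add: field_simps)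
qed

text \<open>In the expanded square the cross term contributes -2|w|^2/c, and by the adjoint bound
  the quadratic term gives back at most |w|^2/c.\<close>

lemma op_bound_residual:
  fixes v :: "'j \<Rightarrow> complex"
  assumes L: "op_bound R J c L" and c: "c > 0"
  defines "w \<equiv> \<lambda>r. \<Sum>j\<in>J. L r j * v j"
  shows "(\<Sum>j\<in>J. (cmod (v j - (\<Sum>r\<in>R. cnj (L r j) * w r) / of_real c))\<^sup>2)
    \<le> (\<Sum>j\<in>J. (cmod (v j))\<^sup>2) - (\<Sum>r\<in>R. (cmod (w r))\<^sup>2) / c"
proof -
  let ?u = "\<lambda>j. \<Sum>r\<in>R. cnj (L r j) * w r"
  have "(\<Sum>j\<in>J. (cmod (?u j))\<^sup>2) / c\<^sup>2 \<le> c * (\<Sum>r\<in>R. (cmod (w r))\<^sup>2) / c\<^sup>2"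
    using op_bound_adjoint[OF L c, of w] by (intro divide_right_mono) simp_all
  also have "\<dots> = (\<Sum>r\<in>R. (cmod (w r))\<^sup>2) / c" using c by (simp add: power2_eq_square)
  finally have 1: "(\<Sum>j\<in>J. (cmod (?u j))\<^sup>2) / c\<^sup>2 \<le> (\<Sum>r\<in>R. (cmod (w r))\<^sup>2) / c" .
  have 2: "Re (\<Sum>j\<in>J. v j * cnj (?u j)) = (\<Sum>r\<in>R. (cmod (w r))\<^sup>2)"
    unfolding adjoint_swap by (subst sum_mult_cnj[symmetric]) (simp only: w_def)
  show ?thesis using 1 unfolding norm2_diff_scaled 2 by simp
qed

text \<open>\<open>\<Omega>\<close> is a bipartite vector; the correction acts on its
  \<open>J\<close> index, separately for each \<open>i\<close>. \<open>K\<close>, \<open>L\<close>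
  and \<open>\<Omega>\<close> all vary in the induction, since pair 0 is peeled off and the others
  are reindexed by \<open>Suc\<close>.\<close>

lemma triangular_contractions_bound:
  fixes K :: "nat \<Rightarrow> 's \<Rightarrow> 'i \<Rightarrow> complex" and L :: "nat \<Rightarrow> 'r \<Rightarrow> 'j \<Rightarrow> complex"
  assumes "cA > 0" "cB > 0"
    and "\<And>k. k < N \<Longrightarrow> op_bound S I cA (K k)"
    and "\<And>k. k < N \<Longrightarrow> op_bound R J cB (L k)"
    and "\<And>k l s r. \<lbrakk>k < N; l < k; s \<in> S; r \<in> R\<rbrakk> \<Longrightarrow> (\<Sum>i\<in>I. \<Sum>j\<in>J. K k s i * L l r j * \<Omega> i j) = 0"
  shows "(\<Sum>k<N. \<Sum>s\<in>S. \<Sum>r\<in>R. (cmod (\<Sum>i\<in>I. \<Sum>j\<in>J. K k s i * L k r j * \<Omega> i j))\<^sup>2)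
    \<le> cA * cB * (\<Sum>i\<in>I. \<Sum>j\<in>J. (cmod (\<Omega> i j))\<^sup>2)"
  using assms(3-5)
proof (induction N arbitrary: K L \<Omega>)
  case 0
  show ?case using assms(1,2) by (simp add: sum_nonneg)
next
  case (Suc N)
  define W where "W i r = (\<Sum>j\<in>J. L 0 r j * \<Omega> i j)" for i r
  \<comment> \<open>Subtracting \<open>L\<^sub>0\<^sup>* L\<^sub>0 \<Omega> / c\<^sub>B\<close> is invisible to every \<open>K\<^sub>k\<close> with \<open>k > 0\<close>, which commutes
    with \<open>L\<^sub>0\<^sup>*\<close> and kills \<open>L\<^sub>0 \<Omega>\<close>.\<close>
  define \<Omega>' where "\<Omega>' i j = \<Omega> i j - (\<Sum>r\<in>R. cnj (L 0 r j) * W i r) / of_real cB" for i j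
  have KW: "(\<Sum>i\<in>I. \<Sum>j\<in>J. K k s i * L 0 r j * \<Omega> i j) = (\<Sum>i\<in>I. K k s i * W i r)" for k s r
    by (simp add: W_def sum_distrib_left mult.assoc)
  have same: "(\<Sum>i\<in>I. \<Sum>j\<in>J. K (Suc k) s i * L l r j * \<Omega>' i j) =
      (\<Sum>i\<in>I. \<Sum>j\<in>J. K (Suc k) s i * L l r j * \<Omega> i j)" if "k < N" "s \<in> S" for k l s r
  proof -
    have z: "(\<Sum>i\<in>I. K (Suc k) s i * W i r') = 0" if "r' \<in> R" for r'
      using Suc.prems(3)[of "Suc k" 0 s r'] that \<open>k < N\<close> \<open>s \<in> S\<close> by (simp add: KW)
    have "(\<Sum>i\<in>I. \<Sum>j\<in>J. K (Suc k) s i * L l r j * (\<Sum>r'\<in>R. cnj (L 0 r' j) * W i r')) =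
        (\<Sum>i\<in>I. \<Sum>j\<in>J. \<Sum>r'\<in>R. L l r j * cnj (L 0 r' j) * (K (Suc k) s i * W i r'))"
      by (simp add: sum_distrib_left mult_ac)
    also have "\<dots> = (\<Sum>j\<in>J. \<Sum>i\<in>I. \<Sum>r'\<in>R. L l r j * cnj (L 0 r' j) * (K (Suc k) s i * W i r'))"
      by (rule sum.swap)
    also have "\<dots> = (\<Sum>j\<in>J. \<Sum>r'\<in>R. \<Sum>i\<in>I. L l r j * cnj (L 0 r' j) * (K (Suc k) s i * W i r'))"
      by (rule sum.cong[OF refl], rule sum.swap)
    also have "\<dots> = (\<Sum>j\<in>J. \<Sum>r'\<in>R. L l r j * cnj (L 0 r' j) * (\<Sum>i\<in>I. K (Suc k) s i * W i r'))"
      by (simp add: sum_distrib_left)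
    also have "\<dots> = 0" by (simp add: z)
    finally have "(\<Sum>i\<in>I. \<Sum>j\<in>J. K (Suc k) s i * L l r j * (\<Sum>r'\<in>R. cnj (L 0 r' j) * W i r')) = 0" .
    then show ?thesis
      by (simp only: \<Omega>'_def right_diff_distrib sum_subtractf times_divide_eq_right
          sum_divide_distrib[symmetric]) simp
  qed
  have "(\<Sum>k<N. \<Sum>s\<in>S. \<Sum>r\<in>R. (cmod (\<Sum>i\<in>I. \<Sum>j\<in>J. K (Suc k) s i * L (Suc k) r j * \<Omega>' i j))\<^sup>2)
      \<le> cA * cB * (\<Sum>i\<in>I. \<Sum>j\<in>J. (cmod (\<Omega>' i j))\<^sup>2)"
    by (rule Suc.IH) (use Suc.prems in \<open>auto simp: same\<close>)
  also have "(\<Sum>i\<in>I. \<Sum>j\<in>J. (cmod (\<Omega>' i j))\<^sup>2)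
      \<le> (\<Sum>i\<in>I. (\<Sum>j\<in>J. (cmod (\<Omega> i j))\<^sup>2) - (\<Sum>r\<in>R. (cmod (W i r))\<^sup>2) / cB)"
    unfolding \<Omega>'_def W_def
    using op_bound_residual[OF Suc.prems(2)[of 0] assms(2)] by (intro sum_mono) simp
  finally have rest: "(\<Sum>k<N. \<Sum>s\<in>S. \<Sum>r\<in>R. (cmod (\<Sum>i\<in>I. \<Sum>j\<in>J. K (Suc k) s i * L (Suc k) r j * \<Omega> i j))\<^sup>2)
      \<le> cA * cB * (\<Sum>i\<in>I. \<Sum>j\<in>J. (cmod (\<Omega> i j))\<^sup>2) - cA * (\<Sum>i\<in>I. \<Sum>r\<in>R. (cmod (W i r))\<^sup>2)"
    using assms(1,2) by (simp add: same sum_subtractf sum_divide_distrib[symmetric] right_diff_distrib)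
  \<comment> \<open>\<open>K 0\<close> acts on each column of \<open>W\<close>, so this term is at
    most the amount subtracted in \<open>rest\<close>.\<close>
  have "(\<Sum>s\<in>S. \<Sum>r\<in>R. (cmod (\<Sum>i\<in>I. \<Sum>j\<in>J. K 0 s i * L 0 r j * \<Omega> i j))\<^sup>2)
      = (\<Sum>r\<in>R. \<Sum>s\<in>S. (cmod (\<Sum>i\<in>I. K 0 s i * W i r))\<^sup>2)"
    unfolding KW by (rule sum.swap)
  also have "\<dots> \<le> (\<Sum>r\<in>R. cA * (\<Sum>i\<in>I. (cmod (W i r))\<^sup>2))"
    by (intro sum_mono op_boundD Suc.prems(1)) simp
  also have "\<dots> = cA * (\<Sum>i\<in>I. \<Sum>r\<in>R. (cmod (W i r))\<^sup>2)"
    by (simp add: sum_distrib_left[symmetric] sum.swap[of _ I R])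
  finally show ?case using rest by (simp only: sum.lessThan_Suc_shift)
qed

section \<open>Registers\<close>

lemma finite_basis [simp]: "finite S \<Longrightarrow> finite (basis P S)"
  unfolding basis_def by (intro finite_PiE) auto

text \<open>The tensor factorisation of the joint space:
  \<open>override_on \<beta> \<alpha> A\<close> glues two basis states, and the two restrictions
  undo the gluing.\<close>

lemma sum_basis_Un:
  assumes "A \<inter> B = {}"
  shows "(\<Sum>\<tau>\<in>basis P (A \<union> B). h \<tau>) = (\<Sum>\<alpha>\<in>basis P A. \<Sum>\<beta>\<in>basis P B. h (override_on \<beta> \<alpha> A))"
  unfolding sum.cartesian_product
  by (rule sum.reindex_bij_witness[where i = "\<lambda>(\<alpha>, \<beta>). override_on \<beta> \<alpha> A"
        and j = "\<lambda>\<tau>. (restrict \<tau> A, restrict \<tau> B)"])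
     (use assms in \<open>auto simp: basis_def PiE_iff override_on_def extensional_def fun_eq_iff
        restrict_def intro!: arg_cong[where f = h]\<close>)

lemma restrict_override_basis:
  assumes "A \<inter> B = {}" "\<alpha> \<in> basis P A" "\<beta> \<in> basis P B"
  shows "restrict (override_on \<beta> \<alpha> A) A = \<alpha>" "restrict (override_on \<beta> \<alpha> A) B = \<beta>"
  using assms by (auto simp: basis_def PiE_iff override_on_def extensional_def fun_eq_iff)

lemma sum_basis_insert:
  assumes "r \<notin> A"
  shows "(\<Sum>\<tau>\<in>basis P (insert r A). h \<tau>) = (\<Sum>i<dim P r. \<Sum>\<sigma>\<in>basis P A. h (\<sigma>(r := i)))"
  unfolding sum.cartesian_product
  by (rule sum.reindex_bij_witness[where i = "\<lambda>(i, \<sigma>). \<sigma>(r := i)"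
        and j = "\<lambda>\<tau>. (\<tau> r, restrict \<tau> A)"])
     (use assms in \<open>auto simp: basis_def PiE_iff extensional_def fun_eq_iff restrict_def
        split: if_splits intro!: arg_cong[where f = h]\<close>)

text \<open>Orthonormal columns recover \<open>v\<close> from its image \<open>w\<close> (fact
  \<open>inverse\<close>); moving \<open>U\<close> across the inner product then turns <w,w> into
  <v,v>. For infinite \<open>B\<close> both sums are 0 by convention.\<close>

lemma unitary_on_isometry:
  assumes "unitary_on B U"
  shows "(\<Sum>\<sigma>\<in>B. (cmod (\<Sum>\<tau>\<in>B. U \<sigma> \<tau> * v \<tau>))\<^sup>2) = (\<Sum>\<tau>\<in>B. (cmod (v \<tau>))\<^sup>2)"
proof (cases "finite B")
  case True
  define w where "w \<sigma> = (\<Sum>\<tau>\<in>B. U \<sigma> \<tau> * v \<tau>)" for \<sigma>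
  have inverse: "(\<Sum>\<sigma>\<in>B. cnj (U \<sigma> \<rho>) * w \<sigma>) = v \<rho>" if "\<rho> \<in> B" for \<rho>
  proof -
    have "(\<Sum>\<sigma>\<in>B. cnj (U \<sigma> \<rho>) * w \<sigma>) = (\<Sum>\<sigma>\<in>B. \<Sum>\<tau>\<in>B. (cnj (U \<sigma> \<rho>) * U \<sigma> \<tau>) * v \<tau>)"
      by (simp add: w_def sum_distrib_left mult_ac)
    also have "\<dots> = (\<Sum>\<tau>\<in>B. \<Sum>\<sigma>\<in>B. (cnj (U \<sigma> \<rho>) * U \<sigma> \<tau>) * v \<tau>)" by (rule sum.swap)
    also have "\<dots> = (\<Sum>\<tau>\<in>B. (if \<rho> = \<tau> then 1 else 0) * v \<tau>)"
      using assms that unfolding unitary_on_def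
      by (intro sum.cong) (simp_all add: sum_distrib_right[symmetric])
    also have "\<dots> = v \<rho>" using True that by (simp add: if_distrib[of "\<lambda>x. x * _"] cong: if_cong)
    finally show ?thesis .
  qed
  have "(\<Sum>\<sigma>\<in>B. w \<sigma> * cnj (w \<sigma>)) = (\<Sum>\<tau>\<in>B. v \<tau> * cnj (\<Sum>\<sigma>\<in>B. cnj (U \<sigma> \<tau>) * w \<sigma>))"
    unfolding adjoint_swap by (simp add: w_def)
  also have "\<dots> = (\<Sum>\<tau>\<in>B. v \<tau> * cnj (v \<tau>))"
    by (intro sum.cong refl) (simp only: inverse)
  finally have "Re (\<Sum>\<sigma>\<in>B. w \<sigma> * cnj (w \<sigma>)) = Re (\<Sum>\<tau>\<in>B. v \<tau> * cnj (v \<tau>))" by simp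
  then show ?thesis unfolding sum_mult_cnj w_def .
qed simp

section \<open>Ownership of registers before and after a round\<close>

lemma finite_held [simp]: "finite (held P t p)"
  unfolding held_def by simp

lemma held_disjoint: "held P t p \<inter> held P t (other p) = {}"
  by (cases p) (auto simp: held_def)

lemma held_Un: "held P t p \<union> held P t (other p) = all_regs P"
  by (cases p) (auto simp: held_def intro: party.exhaust)

lemma held_Suc_sender:
  "sender P t = p \<Longrightarrow> held P (Suc t) p = held P t p - {sent_qubit P t}"
  by (cases p) (auto simp: held_def)

lemma held_Suc_receiver:
  assumes "sender P t \<noteq> p" "sent_qubit P t \<in> held P t (sender P t)"
  shows "held P (Suc t) p = insert (sent_qubit P t) (held P t p)" "sent_qubit P t \<notin> held P t p"
  using assms by (cases p; cases "sender P t"; auto simp: held_def)+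

section \<open>Splitting a protocol into local parts\<close>

text \<open>Prepending the newest bit makes the length of the tail the index of the round that
  produced the head, so \<open>local_op\<close> can recurse on the list alone.\<close>

primrec messages :: "nat \<Rightarrow> nat list set" where
  "messages 0 = {[]}"
| "messages (Suc t) = (\<lambda>(i, m). i # m) ` ({..<2} \<times> messages t)"

lemma finite_messages [simp]: "finite (messages t)"
  by (induction t) auto

lemma card_messages: "card (messages t) = 2 ^ t"
  by (induction t) (auto simp: card_image inj_on_def card_cartesian_product)

lemma length_messages: "m \<in> messages t \<Longrightarrow> length m = t"
  by (induction t arbitrary: m) auto

lemma sum_messages_Suc: "(\<Sum>m\<in>messages (Suc t). g m) = (\<Sum>i<2. \<Sum>m\<in>messages t. g (i # m))"
  by (simp add: sum.reindex inj_on_def sum.cartesian_product case_prod_unfold)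

text \<open>The linear map, from the initial to the current registers of party \<open>p\<close>, that \<open>p\<close> performs
  when every transferred qubit is replaced by a classical bit: the sender projects the qubit onto
  that bit, and the receiver adjoins a fresh qubit in that state. The bits are listed latest
  first.\<close>

primrec local_op ::
    "('a, 'b) protocol \<Rightarrow> party \<Rightarrow> (nat \<Rightarrow> op_matrix) \<Rightarrow> nat list \<Rightarrow> op_matrix" where
  "local_op P p U [] = (\<lambda>\<sigma> \<alpha>. if \<sigma> = \<alpha> then 1 else 0)"
| "local_op P p U (i # m) = (\<lambda>\<sigma> \<alpha>.
     if sender P (length m) = p
     then \<Sum>\<tau>\<in>basis P (held P (length m) p).
            U (length m) (\<sigma>(sent_qubit P (length m) := i)) \<tau> * local_op P p U m \<tau> \<alpha>
     else if \<sigma> (sent_qubit P (length m)) = i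
       then local_op P p U m (restrict \<sigma> (held P (length m) p)) \<alpha> else 0)"

text \<open>All messages are gathered into one operator, from the initial space tensored with a
  message register to the current space: the K or L of the overview.\<close>

definition local_apply ::
    "('a, 'b) protocol \<Rightarrow> party \<Rightarrow> (nat \<Rightarrow> op_matrix) \<Rightarrow> nat \<Rightarrow> (nat list \<Rightarrow> state_vec) \<Rightarrow> state_vec" where
  "local_apply P p U t v = (\<lambda>\<sigma>. \<Sum>m\<in>messages t. \<Sum>\<alpha>\<in>basis P (held P 0 p). local_op P p U m \<sigma> \<alpha> * v m \<alpha>)"

text \<open>For \<open>\<sigma>\<close> on the registers left after sending,
  \<open>\<sigma>(sent_qubit P t := i)\<close> selects the rows of \<open>U t\<close> that survive
  projection of the sent qubit onto \<open>i\<close>.\<close>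

lemma local_apply_Suc_sender:
  assumes "sender P t = p"
  shows "local_apply P p U (Suc t) v \<sigma> = (\<Sum>i<2. \<Sum>\<tau>\<in>basis P (held P t p).
    U t (\<sigma>(sent_qubit P t := i)) \<tau> * local_apply P p U t (\<lambda>m. v (i # m)) \<tau>)"
proof -
  let ?B = "basis P (held P t p)" and ?A = "basis P (held P 0 p)"
  have "(\<Sum>m\<in>messages t. \<Sum>\<alpha>\<in>?A. local_op P p U (i # m) \<sigma> \<alpha> * v (i # m) \<alpha>) =
      (\<Sum>\<tau>\<in>?B. U t (\<sigma>(sent_qubit P t := i)) \<tau> * local_apply P p U t (\<lambda>m. v (i # m)) \<tau>)" for i
  proof -
    let ?g = "\<lambda>m \<alpha> \<tau>. U t (\<sigma>(sent_qubit P t := i)) \<tau> * (local_op P p U m \<tau> \<alpha> * v (i # m) \<alpha>)"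
    have "(\<Sum>m\<in>messages t. \<Sum>\<alpha>\<in>?A. local_op P p U (i # m) \<sigma> \<alpha> * v (i # m) \<alpha>) =
        (\<Sum>m\<in>messages t. \<Sum>\<alpha>\<in>?A. \<Sum>\<tau>\<in>?B. ?g m \<alpha> \<tau>)"
      using assms by (intro sum.cong refl) (simp add: length_messages sum_distrib_right mult.assoc)
    also have "\<dots> = (\<Sum>m\<in>messages t. \<Sum>\<tau>\<in>?B. \<Sum>\<alpha>\<in>?A. ?g m \<alpha> \<tau>)"
      by (rule sum.cong[OF refl], rule sum.swap)
    also have "\<dots> = (\<Sum>\<tau>\<in>?B. \<Sum>m\<in>messages t. \<Sum>\<alpha>\<in>?A. ?g m \<alpha> \<tau>)"
      by (rule sum.swap)
    finally show ?thesis by (simp add: local_apply_def sum_distrib_left)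
  qed
  then show ?thesis unfolding local_apply_def sum_messages_Suc by simp
qed

text \<open>The adjoined qubit is in a basis state, so only messages whose newest bit equals its
  value in \<open>\<sigma>\<close> contribute.\<close>

lemma local_apply_Suc_receiver:
  assumes "sender P t \<noteq> p" "\<sigma> (sent_qubit P t) < 2"
  shows "local_apply P p U (Suc t) v \<sigma> =
    local_apply P p U t (\<lambda>m. v (\<sigma> (sent_qubit P t) # m)) (restrict \<sigma> (held P t p))"
proof -
  have "local_apply P p U (Suc t) v \<sigma> = (\<Sum>i<2. if \<sigma> (sent_qubit P t) = i then
      local_apply P p U t (\<lambda>m. v (i # m)) (restrict \<sigma> (held P t p)) else 0)"
    unfolding local_apply_def sum_messages_Suc
    using assms by (intro sum.cong refl) (simp add: length_messages)
  then show ?thesis using assms(2) by simp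
qed

text \<open>Cauchy-Schwarz for two terms; the source of the factor 2 per sent qubit.\<close>

lemma cmod_sum2_le: "(cmod (\<Sum>i<2. z i))\<^sup>2 \<le> 2 * (\<Sum>i<2::nat. (cmod (z i))\<^sup>2)"
proof -
  have "(cmod (z 0 + z 1))\<^sup>2 \<le> (cmod (z 0) + cmod (z 1))\<^sup>2"
    by (intro power_mono norm_triangle_ineq) simp
  also have "\<dots> \<le> 2 * ((cmod (z 0))\<^sup>2 + (cmod (z 1))\<^sup>2)"
    using zero_le_power2[of "cmod (z 0) - cmod (z 1)"] by (simp add: power2_eq_square algebra_simps)
  finally show ?thesis by (simp add: numeral_2_eq_2)
qed

text \<open>Sending adds two projected branches coherently, which can cost a factor 2. Receiving
  records the bit in a new register, so the branches stay orthogonal and nothing is lost. Hence the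
  exponent counts only the rounds in which \<open>p\<close> sends.\<close>

lemma local_apply_bound:
  assumes "\<And>s. s < t \<Longrightarrow> sent_qubit P s \<in> held P s (sender P s) \<and> dim P (sent_qubit P s) = 2"
    and "\<And>s. s < t \<Longrightarrow> sender P s = p \<Longrightarrow> unitary_on (basis P (held P s p)) (U s)"
  shows "(\<Sum>\<sigma>\<in>basis P (held P t p). (cmod (local_apply P p U t v \<sigma>))\<^sup>2) \<le>
    2 ^ card {s. s < t \<and> sender P s = p} * (\<Sum>m\<in>messages t. \<Sum>\<alpha>\<in>basis P (held P 0 p). (cmod (v m \<alpha>))\<^sup>2)"
  using assms
proof (induction t arbitrary: v)
  case 0
  have "(\<Sum>\<sigma>\<in>basis P (held P 0 p). (cmod (local_apply P p U 0 v \<sigma>))\<^sup>2) =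
      (\<Sum>\<sigma>\<in>basis P (held P 0 p). (cmod (v [] \<sigma>))\<^sup>2)"
    by (intro sum.cong refl)
       (simp add: local_apply_def if_distrib[of "\<lambda>x. x * _"] cong: if_cong)
  then show ?case by simp
next
  case (Suc t)
  let ?r = "sent_qubit P t" and ?c = "(2::real) ^ card {s. s < t \<and> sender P s = p}"
  let ?B = "basis P (held P t p)" and ?A = "basis P (held P 0 p)"
  let ?w = "\<lambda>i. local_apply P p U t (\<lambda>m. v (i # m))"
  have r: "?r \<in> held P t (sender P t)" "dim P ?r = 2" using Suc.prems(1)[of t] by auto
  have IH: "(\<Sum>\<sigma>\<in>?B. (cmod (?w i \<sigma>))\<^sup>2) \<le> ?c * (\<Sum>m\<in>messages t. \<Sum>\<alpha>\<in>?A. (cmod (v (i # m) \<alpha>))\<^sup>2)" for i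
    by (rule Suc.IH) (use Suc.prems in auto)
  have IHsum: "(\<Sum>i<2. \<Sum>\<sigma>\<in>?B. (cmod (?w i \<sigma>))\<^sup>2) \<le>
      ?c * (\<Sum>m\<in>messages (Suc t). \<Sum>\<alpha>\<in>?A. (cmod (v m \<alpha>))\<^sup>2)"
    unfolding sum_messages_Suc sum_distrib_left[of ?c]
    using sum_mono[OF IH, where K = "{..<2}"] by (simp add: sum_distrib_left)
  show ?case
  proof (cases "sender P t = p")
    case True
    have "{s. s < Suc t \<and> sender P s = p} = insert t {s. s < t \<and> sender P s = p}"
      using True by (auto simp: less_Suc_eq)
    then have c: "2 ^ card {s. s < Suc t \<and> sender P s = p} = 2 * ?c" by simp
    define u where "u i \<sigma> = (\<Sum>\<tau>\<in>?B. U t \<sigma> \<tau> * ?w i \<tau>)" for i \<sigma>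
    have ins: "insert ?r (held P (Suc t) p) = held P t p" "?r \<notin> held P (Suc t) p"
      using r(1) True unfolding held_Suc_sender[OF True] by auto
    have "(\<Sum>\<sigma>\<in>basis P (held P (Suc t) p). (cmod (local_apply P p U (Suc t) v \<sigma>))\<^sup>2) \<le>
        (\<Sum>\<sigma>\<in>basis P (held P (Suc t) p). 2 * (\<Sum>i<2. (cmod (u i (\<sigma>(?r := i))))\<^sup>2))"
      unfolding local_apply_Suc_sender[OF True] u_def by (intro sum_mono cmod_sum2_le)
    also have "\<dots> = 2 * (\<Sum>i<2. \<Sum>\<sigma>\<in>basis P (held P (Suc t) p). (cmod (u i (\<sigma>(?r := i))))\<^sup>2)"
      unfolding sum_distrib_left[symmetric] by (simp only: sum.swap[of _ "{..<2}"])
    \<comment> \<open>Only \<open>k = i\<close> is present so far; adding the other value completes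
      the sum to the whole basis before the transfer, where the unitary is isometric.\<close>
    also have "\<dots> \<le> 2 * (\<Sum>i<2. \<Sum>k<2. \<Sum>\<sigma>\<in>basis P (held P (Suc t) p). (cmod (u i (\<sigma>(?r := k))))\<^sup>2)"
      by (intro mult_left_mono sum_mono member_le_sum) (auto simp: sum_nonneg)
    also have "\<dots> = 2 * (\<Sum>i<2. \<Sum>\<tau>\<in>?B. (cmod (u i \<tau>))\<^sup>2)"
      unfolding sum_basis_insert[OF ins(2), where P = P, unfolded ins(1) r(2)] by simp
    also have "\<dots> = 2 * (\<Sum>i<2. \<Sum>\<tau>\<in>?B. (cmod (?w i \<tau>))\<^sup>2)"
      unfolding u_def using Suc.prems(2)[of t] True by (simp add: unitary_on_isometry)
    also have "\<dots> \<le> 2 * (?c * (\<Sum>m\<in>messages (Suc t). \<Sum>\<alpha>\<in>?A. (cmod (v m \<alpha>))\<^sup>2))"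
      using IHsum by (rule mult_left_mono) simp
    finally show ?thesis unfolding c by (simp add: mult.assoc)
  next
    case False
    have c: "{s. s < Suc t \<and> sender P s = p} = {s. s < t \<and> sender P s = p}"
      using False by (auto simp: less_Suc_eq)
    note rec = held_Suc_receiver[OF False r(1)]
    have "(\<Sum>\<sigma>\<in>basis P (held P (Suc t) p). (cmod (local_apply P p U (Suc t) v \<sigma>))\<^sup>2) =
        (\<Sum>i<2. \<Sum>\<sigma>\<in>?B. (cmod (?w i \<sigma>))\<^sup>2)"
      unfolding rec(1) sum_basis_insert[OF rec(2)] r(2)
    proof (intro sum.cong refl)
      fix i \<sigma> assume "i \<in> {..<2::nat}" "\<sigma> \<in> ?B"
      then have "restrict (\<sigma>(?r := i)) (held P t p) = \<sigma>"
        using rec(2) by (auto simp: basis_def PiE_iff extensional_def fun_eq_iff)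
      then show "(cmod (local_apply P p U (Suc t) v (\<sigma>(?r := i))))\<^sup>2 = (cmod (?w i \<sigma>))\<^sup>2"
        using \<open>i \<in> {..<2}\<close> by (simp add: local_apply_Suc_receiver[OF False])
    qed
    then show ?thesis using IHsum unfolding c by simp
  qed
qed

text \<open>The induction step of the factorisation, stated for a sender \<open>p\<close> so that it
  serves both parties. Projection by the sender and preparation by the receiver resolve the identity
  on the transferred qubit.\<close>

lemma apply_op_split:
  assumes p: "sender P t = p" and r: "sent_qubit P t \<in> held P t p" "dim P (sent_qubit P t) = 2"
    and \<psi>: "\<And>\<sigma>. \<sigma> \<in> basis P (all_regs P) \<Longrightarrow> \<psi> \<sigma> = (\<Sum>m\<in>messages t. \<Sum>\<tau>\<in>basis P (all_regs P).
      local_op P p U m (restrict \<sigma> (held P t p)) (restrict \<tau> (held P 0 p)) *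
      local_op P (other p) V m (restrict \<sigma> (held P t (other p))) (restrict \<tau> (held P 0 (other p))) * \<phi> \<tau>)"
    and \<sigma>: "\<sigma> \<in> basis P (all_regs P)"
  shows "apply_op P (held P t p) (U t) \<psi> \<sigma> = (\<Sum>m\<in>messages (Suc t). \<Sum>\<tau>\<in>basis P (all_regs P).
      local_op P p U m (restrict \<sigma> (held P (Suc t) p)) (restrict \<tau> (held P 0 p)) *
      local_op P (other p) V m (restrict \<sigma> (held P (Suc t) (other p))) (restrict \<tau> (held P 0 (other p))) * \<phi> \<tau>)"
proof -
  let ?r = "sent_qubit P t" and ?q = "other p"
  let ?B = "basis P (held P t p)"
  let ?a = "\<lambda>m \<rho> \<tau>. local_op P p U m \<rho> (restrict \<tau> (held P 0 p))"
  let ?b = "\<lambda>m \<rho> \<tau>. local_op P ?q V m \<rho> (restrict \<tau> (held P 0 ?q))"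
  have rA: "?r \<in> all_regs P" using r(1) by (simp add: held_def)
  have i: "\<sigma> ?r < 2" using \<sigma> rA r(2) by (force simp: basis_def PiE_iff)
  have q: "sender P t \<noteq> ?q" using p by (cases p) auto
  have rec: "held P (Suc t) ?q = insert ?r (held P t ?q)" "?r \<notin> held P t ?q"
    using held_Suc_receiver[OF q] r(1) p by auto
  \<comment> \<open>\<open>local_op\<close> writes the bit back into the sender's state; for the bit
    \<open>\<sigma> ?r\<close> this restores the restriction from before the transfer.\<close>
  have resp: "(restrict \<sigma> (held P (Suc t) p))(?r := \<sigma> ?r) = restrict \<sigma> (held P t p)"
    using r(1) unfolding held_Suc_sender[OF p] by (auto simp: fun_eq_iff restrict_def)
  have resq: "restrict (restrict \<sigma> (held P (Suc t) ?q)) (held P t ?q) = restrict \<sigma> (held P t ?q)"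
    unfolding rec(1) by (auto simp: fun_eq_iff restrict_def)
  have "(\<Sum>m\<in>messages (Suc t). \<Sum>\<tau>\<in>basis P (all_regs P).
      ?a m (restrict \<sigma> (held P (Suc t) p)) \<tau> * ?b m (restrict \<sigma> (held P (Suc t) ?q)) \<tau> * \<phi> \<tau>) =
    (\<Sum>i<2. if \<sigma> ?r = i then \<Sum>m\<in>messages t. \<Sum>\<tau>\<in>basis P (all_regs P).
       (\<Sum>\<rho>\<in>?B. U t (restrict \<sigma> (held P t p)) \<rho> * ?a m \<rho> \<tau>) * ?b m (restrict \<sigma> (held P t ?q)) \<tau> * \<phi> \<tau> else 0)"
    unfolding sum_messages_Suc
  proof (intro sum.cong refl)
    fix i :: nat
    show "(\<Sum>m\<in>messages t. \<Sum>\<tau>\<in>basis P (all_regs P).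
      ?a (i # m) (restrict \<sigma> (held P (Suc t) p)) \<tau> * ?b (i # m) (restrict \<sigma> (held P (Suc t) ?q)) \<tau> * \<phi> \<tau>) =
     (if \<sigma> ?r = i then \<Sum>m\<in>messages t. \<Sum>\<tau>\<in>basis P (all_regs P).
       (\<Sum>\<rho>\<in>?B. U t (restrict \<sigma> (held P t p)) \<rho> * ?a m \<rho> \<tau>) * ?b m (restrict \<sigma> (held P t ?q)) \<tau> * \<phi> \<tau> else 0)"
    proof (cases "\<sigma> ?r = i")
      case True
      have "restrict \<sigma> (held P (Suc t) ?q) ?r = i" using True by (simp add: rec(1))
      then show ?thesis using True resp q p
        by (auto simp: length_messages resq simp del: restrict_restrict intro!: sum.cong)
    next
      case False
      have "restrict \<sigma> (held P (Suc t) ?q) ?r \<noteq> i" using False by (simp add: rec(1))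
      then show ?thesis using False q
        by (auto simp: length_messages intro!: sum.neutral)
    qed
  qed
  \<comment> \<open>Since \<open>\<sigma> ?r < 2\<close>, exactly one value of the newest bit
    survives.\<close>
  also have "\<dots> = (\<Sum>m\<in>messages t. \<Sum>\<tau>\<in>basis P (all_regs P). \<Sum>\<rho>\<in>?B.
       U t (restrict \<sigma> (held P t p)) \<rho> * (?a m \<rho> \<tau> * ?b m (restrict \<sigma> (held P t ?q)) \<tau> * \<phi> \<tau>))"
    using i by (simp add: sum_distrib_right mult.assoc)
  also have "\<dots> = (\<Sum>m\<in>messages t. \<Sum>\<rho>\<in>?B. \<Sum>\<tau>\<in>basis P (all_regs P).
       U t (restrict \<sigma> (held P t p)) \<rho> * (?a m \<rho> \<tau> * ?b m (restrict \<sigma> (held P t ?q)) \<tau> * \<phi> \<tau>))"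
    by (rule sum.cong[OF refl], rule sum.swap)
  also have "\<dots> = (\<Sum>\<rho>\<in>?B. \<Sum>m\<in>messages t. \<Sum>\<tau>\<in>basis P (all_regs P).
       U t (restrict \<sigma> (held P t p)) \<rho> * (?a m \<rho> \<tau> * ?b m (restrict \<sigma> (held P t ?q)) \<tau> * \<phi> \<tau>))"
    by (rule sum.swap)
  \<comment> \<open>Overriding \<open>\<sigma>\<close> by \<open>\<rho>\<close> on the sender's
    registers leaves the receiver's part unchanged, so the inner sums are the assumed factorisation
    of \<open>\<psi>\<close>.\<close>
  also have "\<dots> = (\<Sum>\<rho>\<in>?B. U t (restrict \<sigma> (held P t p)) \<rho> * \<psi> (override_on \<sigma> \<rho> (held P t p)))"
  proof (intro sum.cong refl)
    fix \<rho> assume \<rho>: "\<rho> \<in> ?B"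
    have "override_on \<sigma> \<rho> (held P t p) \<in> basis P (all_regs P)"
      using \<sigma> \<rho> by (auto simp: basis_def PiE_iff override_on_def extensional_def held_def)
    moreover have "restrict (override_on \<sigma> \<rho> (held P t p)) (held P t p) = \<rho>"
      using \<rho> by (auto simp: basis_def PiE_iff override_on_def extensional_def fun_eq_iff)
    moreover have "restrict (override_on \<sigma> \<rho> (held P t p)) (held P t ?q) = restrict \<sigma> (held P t ?q)"
      using held_disjoint[of P t p] by (auto simp: override_on_def fun_eq_iff restrict_def)
    ultimately show "(\<Sum>m\<in>messages t. \<Sum>\<tau>\<in>basis P (all_regs P).
       U t (restrict \<sigma> (held P t p)) \<rho> * (?a m \<rho> \<tau> * ?b m (restrict \<sigma> (held P t ?q)) \<tau> * \<phi> \<tau>)) =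
       U t (restrict \<sigma> (held P t p)) \<rho> * \<psi> (override_on \<sigma> \<rho> (held P t p))"
      by (simp add: \<psi> sum_distrib_left)
  qed
  finally show ?thesis by (simp add: apply_op_def)
qed

lemma state_after_split:
  assumes "\<And>s. s < t \<Longrightarrow> sent_qubit P s \<in> held P s (sender P s) \<and> dim P (sent_qubit P s) = 2"
    and "\<sigma> \<in> basis P (all_regs P)"
  shows "state_after P x y t \<sigma> = (\<Sum>m\<in>messages t. \<Sum>\<tau>\<in>basis P (all_regs P).
      local_op P Alice (\<lambda>s. alice_op P s x) m (restrict \<sigma> (held P t Alice)) (restrict \<tau> (held P 0 Alice)) *
      local_op P Bob (\<lambda>s. bob_op P s y) m (restrict \<sigma> (held P t Bob)) (restrict \<tau> (held P 0 Bob)) *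
      init_state P \<tau>)"
  using assms
proof (induction t arbitrary: \<sigma>)
  case 0
  \<comment> \<open>Before any round both local maps are identities; their two Kronecker deltas
    multiply to the delta on the joint basis.\<close>
  have eq: "restrict \<sigma> (held P 0 Alice) = restrict \<tau> (held P 0 Alice) \<and>
      restrict \<sigma> (held P 0 Bob) = restrict \<tau> (held P 0 Bob) \<longleftrightarrow> \<sigma> = \<tau>"
    if "\<tau> \<in> basis P (all_regs P)" for \<tau>
  proof
    assume *: "restrict \<sigma> (held P 0 Alice) = restrict \<tau> (held P 0 Alice) \<and>
      restrict \<sigma> (held P 0 Bob) = restrict \<tau> (held P 0 Bob)"
    show "\<sigma> = \<tau>"
    proof (rule PiE_ext)
      show "\<sigma> \<in> (\<Pi>\<^sub>E r\<in>all_regs P. {..<dim P r})" "\<tau> \<in> (\<Pi>\<^sub>E r\<in>all_regs P. {..<dim P r})"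
        using 0(2) that by (simp_all add: basis_def)
      fix r assume "r \<in> all_regs P"
      then have "r \<in> held P 0 Alice \<or> r \<in> held P 0 Bob"
        using held_Un[of P 0 Alice] by auto
      then show "\<sigma> r = \<tau> r" using * by (metis restrict_apply')
    qed
  qed simp
  have "(\<Sum>\<tau>\<in>basis P (all_regs P). (if restrict \<sigma> (held P 0 Alice) = restrict \<tau> (held P 0 Alice) then 1 else 0) *
      (if restrict \<sigma> (held P 0 Bob) = restrict \<tau> (held P 0 Bob) then 1 else 0) * init_state P \<tau>) =
      (\<Sum>\<tau>\<in>basis P (all_regs P). if \<sigma> = \<tau> then init_state P \<tau> else 0)"
    by (intro sum.cong refl) (use eq in auto)
  also have "\<dots> = init_state P \<sigma>" using 0(2) by simp
  finally show ?case
    by (simp only: messages.simps state_after.simps local_op.simps sum.insert sum.empty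
        finite.emptyI empty_iff not_False_eq_True add_0_right)
next
  case (Suc t)
  have r: "sent_qubit P t \<in> held P t (sender P t)" "dim P (sent_qubit P t) = 2"
    using Suc.prems(1)[of t] by auto
  have IH: "state_after P x y t \<sigma> = (\<Sum>m\<in>messages t. \<Sum>\<tau>\<in>basis P (all_regs P).
      local_op P Alice (\<lambda>s. alice_op P s x) m (restrict \<sigma> (held P t Alice)) (restrict \<tau> (held P 0 Alice)) *
      local_op P Bob (\<lambda>s. bob_op P s y) m (restrict \<sigma> (held P t Bob)) (restrict \<tau> (held P 0 Bob)) *
      init_state P \<tau>)" if "\<sigma> \<in> basis P (all_regs P)" for \<sigma>
    by (rule Suc.IH) (use Suc.prems that in auto)
  show ?case
  proof (cases "sender P t")
    case Alice
    have "state_after P x y (Suc t) \<sigma> =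
        apply_op P (held P t Alice) (alice_op P t x) (state_after P x y t) \<sigma>"
      by (simp only: state_after.simps round_op_def Alice party.case)
    also note apply_op_split[OF Alice, unfolded other.simps, OF r[unfolded Alice] IH Suc.prems(2)]
    finally show ?thesis .
  next
    case Bob
    \<comment> \<open>\<open>apply_op_split\<close> expects the sender's factor first, which is now
      Bob's.\<close>
    have IH': "state_after P x y t \<sigma> = (\<Sum>m\<in>messages t. \<Sum>\<tau>\<in>basis P (all_regs P).
        local_op P Bob (\<lambda>s. bob_op P s y) m (restrict \<sigma> (held P t Bob)) (restrict \<tau> (held P 0 Bob)) *
        local_op P Alice (\<lambda>s. alice_op P s x) m (restrict \<sigma> (held P t Alice)) (restrict \<tau> (held P 0 Alice)) *
        init_state P \<tau>)" if "\<sigma> \<in> basis P (all_regs P)" for \<sigma>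
      unfolding IH[OF that] by (intro sum.cong refl) (simp only: mult_ac)
    have "state_after P x y (Suc t) \<sigma> =
        apply_op P (held P t Bob) (bob_op P t y) (state_after P x y t) \<sigma>"
      by (simp only: state_after.simps round_op_def Bob party.case)
    also note apply_op_split[OF Bob, unfolded other.simps, OF r[unfolded Bob] IH' Suc.prems(2)]
    finally show ?thesis by (simp only: mult.commute mult.left_commute)
  qed
qed

section \<open>The communication bound\<close>

text \<open>One factor \<open>2 ^ q\<close> of the bound is the product of the two parties' operator
  bounds; the other is the squared norm of \<open>\<Omega>\<close>.\<close>

lemma qubit_protocol_triangular_bound:
  fixes N :: nat
  assumes P: "qubit_protocol q X Y P"
    and xy: "\<And>k. k < N \<Longrightarrow> x k \<in> X \<and> y k \<in> Y"
    and zero: "\<And>k l. k < N \<Longrightarrow> l < k \<Longrightarrow> prob_one q P (x k) (y l) = 0"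
  shows "(\<Sum>k<N. prob_one q P (x k) (y k)) \<le> 4 ^ q"
proof -
  define r where "r = sent_qubit P (q - 1)"
  define I where "I p = messages q \<times> basis P (held P 0 p)" for p
  \<comment> \<open>Exactly one of the two parties holds \<open>r\<close> at the end, so exactly one of these sets encodes
    the event that the output is 1.\<close>
  define S where "S p = {\<sigma> \<in> basis P (held P q p). r \<in> held P q p \<longrightarrow> \<sigma> r = 1}" for p
  define K where "K k s i = local_op P Alice (\<lambda>t. alice_op P t (x k)) (fst i) s (snd i)" for k s and i :: "nat list \<times> basis_state"
  define L where "L k s i = local_op P Bob (\<lambda>t. bob_op P t (y k)) (fst i) s (snd i)" for k s and i :: "nat list \<times> basis_state"
  \<comment> \<open>The initial state together with an unnormalised maximally entangled pair of
    message registers: \<open>fst i = fst j\<close> makes both parties use the same message.\<close>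
  define \<Omega> where "\<Omega> i j = (if fst i = fst j then init_state P (override_on (snd j) (snd i) (held P 0 Alice)) else 0)"
    for i j :: "nat list \<times> basis_state"
  define c :: "party \<Rightarrow> real" where "c p = 2 ^ card {s. s < q \<and> sender P s = p}" for p
  let ?A = "\<lambda>t. held P t Alice" and ?B = "\<lambda>t. held P t Bob"
  have q: "q \<ge> 1" and sent: "\<And>t. t < q \<Longrightarrow> sent_qubit P t \<in> held P t (sender P t) \<and> dim P (sent_qubit P t) = 2"
    and uA: "\<And>t x. t < q \<Longrightarrow> sender P t = Alice \<Longrightarrow> x \<in> X \<Longrightarrow> unitary_on (basis P (?A t)) (alice_op P t x)"
    and uB: "\<And>t y. t < q \<Longrightarrow> sender P t = Bob \<Longrightarrow> y \<in> Y \<Longrightarrow> unitary_on (basis P (?B t)) (bob_op P t y)"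
    and norm: "(\<Sum>\<sigma>\<in>basis P (all_regs P). (cmod (init_state P \<sigma>))\<^sup>2) = 1"
    using P unfolding qubit_protocol_def by auto
  have disj: "?A t \<inter> ?B t = {}" and Un: "all_regs P = ?A t \<union> ?B t" for t
    using held_disjoint[of P t Alice] held_Un[of P t Alice] by simp_all
  have r: "r \<in> all_regs P" using sent[of "q - 1"] q unfolding r_def held_def by auto
  have finS: "finite (basis P (held P q p))" for p by simp
  have bound: "op_bound (S p) (I p) (c p) (\<lambda>s i. local_op P p U (fst i) s (snd i))"
    if "\<And>s. s < q \<Longrightarrow> sender P s = p \<Longrightarrow> unitary_on (basis P (held P s p)) (U s)" for p U
    unfolding op_bound_def
  proof
    fix v :: "nat list \<times> basis_state \<Rightarrow> complex"
    have eq: "(\<Sum>i\<in>I p. local_op P p U (fst i) s (snd i) * v i) = local_apply P p U q (\<lambda>m \<alpha>. v (m, \<alpha>)) s" for s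
      unfolding local_apply_def I_def sum.cartesian_product by (intro sum.cong) auto
    have "(\<Sum>s\<in>S p. (cmod (local_apply P p U q (\<lambda>m \<alpha>. v (m, \<alpha>)) s))\<^sup>2) \<le>
        (\<Sum>s\<in>basis P (held P q p). (cmod (local_apply P p U q (\<lambda>m \<alpha>. v (m, \<alpha>)) s))\<^sup>2)"
      by (rule sum_mono2) (auto simp: S_def)
    also have "\<dots> \<le> c p * (\<Sum>m\<in>messages q. \<Sum>\<alpha>\<in>basis P (held P 0 p). (cmod (v (m, \<alpha>)))\<^sup>2)"
      unfolding c_def by (rule local_apply_bound) (use sent that in auto)
    also have "(\<Sum>m\<in>messages q. \<Sum>\<alpha>\<in>basis P (held P 0 p). (cmod (v (m, \<alpha>)))\<^sup>2) = (\<Sum>i\<in>I p. (cmod (v i))\<^sup>2)"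
      unfolding I_def sum.cartesian_product by (intro sum.cong) auto
    finally show "(\<Sum>s\<in>S p. (cmod (\<Sum>i\<in>I p. local_op P p U (fst i) s (snd i) * v i))\<^sup>2) \<le> c p * (\<Sum>i\<in>I p. (cmod (v i))\<^sup>2)"
      unfolding eq .
  qed
  have amp: "state_after P (x k) (y l) q (override_on \<sigma>' \<sigma> (?A q)) = (\<Sum>i\<in>I Alice. \<Sum>j\<in>I Bob. K k \<sigma> i * L l \<sigma>' j * \<Omega> i j)"
    if "\<sigma> \<in> basis P (?A q)" "\<sigma>' \<in> basis P (?B q)" for k l \<sigma> \<sigma>'
  proof -
    let ?a = "local_op P Alice (\<lambda>t. alice_op P t (x k))" and ?b = "local_op P Bob (\<lambda>t. bob_op P t (y l))"
    have "override_on \<sigma>' \<sigma> (?A q) \<in> basis P (all_regs P)"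
      unfolding Un[of q] using that by (auto simp: basis_def PiE_iff override_on_def extensional_def)
    then have "state_after P (x k) (y l) q (override_on \<sigma>' \<sigma> (?A q)) =
        (\<Sum>m\<in>messages q. \<Sum>\<tau>\<in>basis P (?A 0 \<union> ?B 0). ?a m \<sigma> (restrict \<tau> (?A 0)) * ?b m \<sigma>' (restrict \<tau> (?B 0)) * init_state P \<tau>)"
      unfolding Un[of 0, symmetric] using state_after_split[of q P, OF sent]
      by (simp only: restrict_override_basis[OF disj that])
    also have "\<dots> = (\<Sum>m\<in>messages q. \<Sum>\<alpha>\<in>basis P (?A 0). \<Sum>\<beta>\<in>basis P (?B 0).
        ?a m \<sigma> \<alpha> * ?b m \<sigma>' \<beta> * init_state P (override_on \<beta> \<alpha> (?A 0)))"
      unfolding sum_basis_Un[OF disj]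
      by (intro sum.cong refl) (simp only: restrict_override_basis[OF disj])
    \<comment> \<open>An independent message \<open>m'\<close> for Bob is introduced through a
      delta, which \<open>\<Omega>\<close> then absorbs.\<close>
    also have "\<dots> = (\<Sum>m\<in>messages q. \<Sum>\<alpha>\<in>basis P (?A 0). \<Sum>m'\<in>messages q. if m = m' then \<Sum>\<beta>\<in>basis P (?B 0).
        ?a m \<sigma> \<alpha> * ?b m \<sigma>' \<beta> * init_state P (override_on \<beta> \<alpha> (?A 0)) else 0)"
      by simp
    also have "\<dots> = (\<Sum>m\<in>messages q. \<Sum>\<alpha>\<in>basis P (?A 0). \<Sum>m'\<in>messages q. \<Sum>\<beta>\<in>basis P (?B 0).
        K k \<sigma> (m, \<alpha>) * L l \<sigma>' (m', \<beta>) * \<Omega> (m, \<alpha>) (m', \<beta>))"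
      by (intro sum.cong refl) (simp add: K_def L_def \<Omega>_def)
    also have "\<dots> = (\<Sum>i\<in>I Alice. \<Sum>j\<in>I Bob. K k \<sigma> i * L l \<sigma>' j * \<Omega> i j)"
      unfolding I_def by (simp only: sum.cartesian_product')
    finally show ?thesis .
  qed
  have prob: "prob_one q P (x k) (y l) = (\<Sum>\<sigma>\<in>S Alice. \<Sum>\<sigma>'\<in>S Bob.
      (cmod (\<Sum>i\<in>I Alice. \<Sum>j\<in>I Bob. K k \<sigma> i * L l \<sigma>' j * \<Omega> i j))\<^sup>2)" for k l
  proof -
    let ?g = "\<lambda>\<sigma>. (cmod (state_after P (x k) (y l) q \<sigma>))\<^sup>2"
    have out: "override_on \<sigma>' \<sigma> (?A q) r = 1 \<longleftrightarrow> \<sigma> \<in> S Alice \<and> \<sigma>' \<in> S Bob"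
      if "\<sigma> \<in> basis P (?A q)" "\<sigma>' \<in> basis P (?B q)" for \<sigma> \<sigma>'
      using that r disj[of q] Un[of q] by (auto simp: S_def override_on_def)
    have "prob_one q P (x k) (y l) = (\<Sum>\<sigma>\<in>basis P (?A q \<union> ?B q). if \<sigma> r = 1 then ?g \<sigma> else 0)"
      unfolding prob_one_def r_def[symmetric] Un[of q, symmetric]
      by (rule sum.mono_neutral_cong_left) (auto)
    also have "\<dots> = (\<Sum>\<sigma>\<in>basis P (?A q). \<Sum>\<sigma>'\<in>basis P (?B q).
        if \<sigma> \<in> S Alice \<and> \<sigma>' \<in> S Bob then ?g (override_on \<sigma>' \<sigma> (?A q)) else 0)"
      unfolding sum_basis_Un[OF disj] by (intro sum.cong refl) (simp only: out)
    also have "\<dots> = (\<Sum>\<sigma>\<in>basis P (?A q). if \<sigma> \<in> S Alice then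
        \<Sum>\<sigma>'\<in>basis P (?B q). if \<sigma>' \<in> S Bob then ?g (override_on \<sigma>' \<sigma> (?A q)) else 0 else 0)"
      by (intro sum.cong refl) simp
    also have "\<dots> = (\<Sum>\<sigma>\<in>basis P (?A q) \<inter> S Alice. \<Sum>\<sigma>'\<in>basis P (?B q) \<inter> S Bob. ?g (override_on \<sigma>' \<sigma> (?A q)))"
      by (simp only: sum.inter_restrict[OF finS])
    also have "basis P (?A q) \<inter> S Alice = S Alice" by (auto simp: S_def)
    also have "basis P (?B q) \<inter> S Bob = S Bob" by (auto simp: S_def)
    also have "(\<Sum>\<sigma>\<in>S Alice. \<Sum>\<sigma>'\<in>S Bob. ?g (override_on \<sigma>' \<sigma> (?A q))) = (\<Sum>\<sigma>\<in>S Alice. \<Sum>\<sigma>'\<in>S Bob.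
      (cmod (\<Sum>i\<in>I Alice. \<Sum>j\<in>I Bob. K k \<sigma> i * L l \<sigma>' j * \<Omega> i j))\<^sup>2)"
      by (intro sum.cong refl) (simp add: amp S_def)
    finally show ?thesis .
  qed
  have finS': "finite (S p)" for p unfolding S_def by simp
  have "(\<Sum>k<N. prob_one q P (x k) (y k)) \<le> c Alice * c Bob * (\<Sum>i\<in>I Alice. \<Sum>j\<in>I Bob. (cmod (\<Omega> i j))\<^sup>2)"
    unfolding prob
  proof (rule triangular_contractions_bound)
    show "0 < c Alice" "0 < c Bob" by (simp_all add: c_def)
    show "op_bound (S Alice) (I Alice) (c Alice) (K k)" if "k < N" for k
      using bound[of Alice "\<lambda>t. alice_op P t (x k)"] uA xy[OF that] unfolding K_def by blast
    show "op_bound (S Bob) (I Bob) (c Bob) (L k)" if "k < N" for k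
      using bound[of Bob "\<lambda>t. bob_op P t (y k)"] uB xy[OF that] unfolding L_def by blast
    fix k l \<sigma> \<sigma>' assume kl: "k < N" "l < k" and \<sigma>: "\<sigma> \<in> S Alice" "\<sigma>' \<in> S Bob"
    \<comment> \<open>A vanishing probability is a vanishing sum of squares, so every amplitude is
      zero.\<close>
    have "\<forall>\<sigma>\<in>S Alice. \<forall>\<sigma>'\<in>S Bob. (cmod (\<Sum>i\<in>I Alice. \<Sum>j\<in>I Bob. K k \<sigma> i * L l \<sigma>' j * \<Omega> i j))\<^sup>2 = 0"
      using zero[OF kl] unfolding prob
      by (simp add: sum_nonneg_eq_0_iff finS' sum_nonneg)
    then show "(\<Sum>i\<in>I Alice. \<Sum>j\<in>I Bob. K k \<sigma> i * L l \<sigma>' j * \<Omega> i j) = 0"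
      using \<sigma> by simp
  qed
  \<comment> \<open>Each round has exactly one sender, so the two exponents add up to
    \<open>q\<close>.\<close>
  also have "c Alice * c Bob = 2 ^ q"
  proof -
    have "card ({s. s < q \<and> sender P s = Alice} \<union> {s. s < q \<and> sender P s = Bob}) =
        card {s. s < q \<and> sender P s = Alice} + card {s. s < q \<and> sender P s = Bob}"
      by (rule card_Un_disjoint) auto
    moreover have "{s. s < q \<and> sender P s = Alice} \<union> {s. s < q \<and> sender P s = Bob} = {..<q}"
      by (auto intro: party.exhaust)
    ultimately show ?thesis unfolding c_def by (simp add: power_add[symmetric])
  qed
  \<comment> \<open>Each of the \<open>2 ^ q\<close> messages contributes one copy of the unit
    vector \<open>init_state P\<close>.\<close>
  also have "(\<Sum>i\<in>I Alice. \<Sum>j\<in>I Bob. (cmod (\<Omega> i j))\<^sup>2) = 2 ^ q"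
  proof -
    have "(\<Sum>i\<in>I Alice. \<Sum>j\<in>I Bob. (cmod (\<Omega> i j))\<^sup>2) =
        (\<Sum>m\<in>messages q. \<Sum>\<alpha>\<in>basis P (?A 0). \<Sum>m'\<in>messages q. \<Sum>\<beta>\<in>basis P (?B 0).
          (cmod (\<Omega> (m, \<alpha>) (m', \<beta>)))\<^sup>2)"
      unfolding I_def by (simp only: sum.cartesian_product')
    also have "\<dots> = (\<Sum>m\<in>messages q. \<Sum>\<alpha>\<in>basis P (?A 0). \<Sum>m'\<in>messages q. if m = m' then
        \<Sum>\<beta>\<in>basis P (?B 0). (cmod (init_state P (override_on \<beta> \<alpha> (?A 0))))\<^sup>2 else 0)"
      by (intro sum.cong refl) (simp add: \<Omega>_def)
    also have "\<dots> = (\<Sum>m\<in>messages q. \<Sum>\<tau>\<in>basis P (?A 0 \<union> ?B 0). (cmod (init_state P \<tau>))\<^sup>2)"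
      unfolding sum_basis_Un[OF disj] by simp
    also have "\<dots> = 2 ^ q"
      unfolding Un[of 0, symmetric] norm by (simp add: card_messages)
    finally show ?thesis .
  qed
  finally show ?thesis by (simp add: power_mult_distrib[symmetric])
qed

section \<open>From the bound for protocols to the logarithmic bound on complexity\<close>

theorem theorem1:
  fixes X :: "'a set" and Y :: "'b set" and f :: "'a \<Rightarrow> 'b \<Rightarrow> bool" and N :: nat
  assumes "finite X" and "finite Y"
    and "N \<ge> 1"
    and "\<exists>F. one_fooling_set X Y f F \<and> upper_triangular f F N"
  shows "ereal_of_enat (Q1_star X Y f) \<ge> ereal (1 / 2 * log 2 (real N) - 1 / 2)"
proof -
  obtain F e where F: "one_fooling_set X Y f F" and e: "bij_betw e {1..N} F"
    and tri: "\<And>i j. i \<in> {1..N} \<Longrightarrow> j \<in> {1..N} \<Longrightarrow> i > j \<Longrightarrow> \<not> f (fst (e i)) (snd (e j))"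
    using assms(4) unfolding upper_triangular_def by blast
  define x where "x k = fst (e (Suc k))" for k
  define y where "y k = snd (e (Suc k))" for k
  have inF: "(x k, y k) \<in> F" if "k < N" for k
    using bij_betwE[OF e] that by (simp add: x_def y_def)
  have xy: "x k \<in> X \<and> y k \<in> Y" and one: "f (x k) (y k)" if "k < N" for k
    using F inF[OF that] unfolding one_fooling_set_def by auto
  have bound: "1 / 2 * log 2 (real N) - 1 / 2 \<le> real q"
    if P: "qubit_protocol q X Y P" and comp: "computes_one_sided q X Y f P" for q P
  proof -
    have "prob_one q P (x k) (y l) = 0" if "k < N" "l < k" for k l
      using comp tri[of "Suc k" "Suc l"] xy[of k] xy[of l] that
      unfolding computes_one_sided_def by (auto simp: x_def y_def)
    then have le: "(\<Sum>k<N. prob_one q P (x k) (y k)) \<le> 4 ^ q"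
      using qubit_protocol_triangular_bound[OF P, of N x y] xy by blast
    have "real N / 2 = (\<Sum>k<N. 1 / 2)" by simp
    also have "\<dots> \<le> (\<Sum>k<N. prob_one q P (x k) (y k))"
      using comp xy one unfolding computes_one_sided_def by (intro sum_mono) auto
    finally have "real N \<le> 2 * 4 ^ q" using le by simp
    \<comment> \<open>The extra 1 in the exponent comes from the success probability 1/2, and
      becomes the term -1/2 after halving.\<close>
    also have "\<dots> = 2 ^ (2 * q + 1)" by (simp add: power_mult)
    finally have "log 2 (real N) \<le> real (2 * q + 1)"
      using assms(3) by (simp add: log_le_iff powr_realpow[symmetric] powr_add)
    then show ?thesis by simp
  qed
  let ?Q = "{enat q | q. \<exists>P. qubit_protocol q X Y P \<and> computes_one_sided q X Y f P}"
  show ?thesis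
  proof (cases "?Q = {}")
    case True
    \<comment> \<open>Without any protocol the infimum is infinite and the bound is trivial.\<close>
    show ?thesis unfolding Q1_star_def True by (simp add: top_enat_def)
  next
    case False
    then obtain n where "n \<in> ?Q" by blast
    \<comment> \<open>The order on \<open>enat\<close> is a well-order, so the infimum of a nonempty
      set is attained by an actual protocol.\<close>
    then have "(LEAST n. n \<in> ?Q) \<in> ?Q" by (rule LeastI[where P = "\<lambda>n. n \<in> ?Q"])
    then have "Inf ?Q \<in> ?Q" using False by (simp only: Inf_enat_def if_False)
    then obtain q P where "Inf ?Q = enat q" "qubit_protocol q X Y P" "computes_one_sided q X Y f P"
      by auto
    then show ?thesis using bound unfolding Q1_star_def by simp
  qed
qed

end
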